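(* (i) There is no bounded projection from the space of compact operators on $\ell^2(\mathbb{N})$ onto the subspace of compact Helson matrices. (ii) There is no bounded projection from the space of bounded operators on $\ell^2(\mathbb{N})$ onto the subspace of bounded Helson matrices.
   Context: $\mathbb{N}=\{1,2,3,\dots\}$. Operators on $\ell^2(\mathbb{N})$ are identified with their matrices in the standard orthonormal basis, and the spaces of compact and of bounded operators carry the operator norm. A Helson matrix is an infinite matrix of the form $(\varrho_{mn})_{m,n\geq1}$ for some sequence of complex numbers $(\varrho_k)_{k\geq1}$; a compact (resp. bounded) Helson matrix is a Helson matrix that defines a compact (resp. bounded) operator on $\ell^2(\mathbb{N})$. A bounded projection from a normed space $X$ onto a subspace $Y$ is a bounded linear map $Q\colon X\to X$ with $Q^2=Q$ and range equal to $Y$. *)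

theory Defs
  imports "HOL-Analysis.Analysis"
begin

text \<open>
  The space \<open>\<ell>\<^sup>2\<close> over the index set \<open>{1, 2, 3, \<dots>}\<close>: square-summable complex sequences. The index
  \<open>0\<close> of type \<^typ>\<open>nat\<close> is made void by requiring the value \<open>0\<close> there, so that matrix entries are
  indexed by \<open>m, n \<ge> 1\<close> without a shift.
\<close>

typedef ell2 = "{x :: nat \<Rightarrow> complex. x 0 = 0 \<and> summable (\<lambda>n. (cmod (x n))\<^sup>2)}"
  morphisms ell2_nth Abs_ell2
  by (rule exI[of _ "\<lambda>_. 0"]) simp

setup_lifting type_definition_ell2

lemma summable_cmod_square_add:
  assumes "summable (\<lambda>n. (cmod (x n))\<^sup>2)" "summable (\<lambda>n. (cmod (y n))\<^sup>2)"
  shows "summable (\<lambda>n. (cmod (x n + y n))\<^sup>2)"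
proof (rule summable_comparison_test'[where N = 0])
  show "summable (\<lambda>n. 2 * (cmod (x n))\<^sup>2 + 2 * (cmod (y n))\<^sup>2)"
    by (intro summable_add summable_mult assms)
  fix n :: nat
  have "(cmod (x n + y n))\<^sup>2 \<le> (cmod (x n) + cmod (y n))\<^sup>2"
    by (intro power_mono norm_triangle_ineq) simp
  also have "\<dots> \<le> 2 * (cmod (x n))\<^sup>2 + 2 * (cmod (y n))\<^sup>2"
    using sum_squares_bound[of "cmod (x n)" "cmod (y n)"] by (simp add: power2_sum)
  finally show "norm ((cmod (x n + y n))\<^sup>2) \<le> 2 * (cmod (x n))\<^sup>2 + 2 * (cmod (y n))\<^sup>2"
    by simp
qed

lemma summable_inner_square:
  fixes x y :: "nat \<Rightarrow> complex"
  assumes "summable (\<lambda>n. (cmod (x n))\<^sup>2)" "summable (\<lambda>n. (cmod (y n))\<^sup>2)"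
  shows "summable (\<lambda>n. x n \<bullet> y n)"
proof (rule summable_comparison_test'[where N = 0])
  show "summable (\<lambda>n. (cmod (x n))\<^sup>2 + (cmod (y n))\<^sup>2)"
    by (intro summable_add assms)
  fix n :: nat
  have "\<bar>x n \<bullet> y n\<bar> \<le> cmod (x n) * cmod (y n)"
    by (rule Cauchy_Schwarz_ineq2)
  also have "\<dots> \<le> (cmod (x n))\<^sup>2 + (cmod (y n))\<^sup>2"
    using sum_squares_bound[of "cmod (x n)" "cmod (y n)"]
      mult_nonneg_nonneg[OF norm_ge_zero[of "x n"] norm_ge_zero[of "y n"]]
    by linarith
  finally show "norm (x n \<bullet> y n) \<le> (cmod (x n))\<^sup>2 + (cmod (y n))\<^sup>2"
    by simp
qed

lift_definition cscale :: "complex \<Rightarrow> ell2 \<Rightarrow> ell2" is "\<lambda>c x n. c * x n"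
  by (simp add: norm_mult power_mult_distrib)

text \<open>
  The real inner product below is the real part of the usual sesquilinear one; both induce the same
  norm \<open>sqrt (\<Sum>n. (cmod (x n))\<^sup>2)\<close>.
\<close>

instantiation ell2 :: real_inner
begin

lift_definition zero_ell2 :: ell2 is "\<lambda>_. 0" by simp

lift_definition plus_ell2 :: "ell2 \<Rightarrow> ell2 \<Rightarrow> ell2" is "\<lambda>x y n. x n + y n"
  by (simp add: summable_cmod_square_add)

lift_definition uminus_ell2 :: "ell2 \<Rightarrow> ell2" is "\<lambda>x n. - x n" by simp

lift_definition minus_ell2 :: "ell2 \<Rightarrow> ell2 \<Rightarrow> ell2" is "\<lambda>x y n. x n - y n"
  subgoal for x y using summable_cmod_square_add[of x "\<lambda>n. - y n"] by simp
  done

lift_definition scaleR_ell2 :: "real \<Rightarrow> ell2 \<Rightarrow> ell2" is "\<lambda>r x n. r *\<^sub>R x n"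
  by (simp add: power_mult_distrib)

lift_definition inner_ell2 :: "ell2 \<Rightarrow> ell2 \<Rightarrow> real" is "\<lambda>x y. \<Sum>n. x n \<bullet> y n" .

lift_definition norm_ell2 :: "ell2 \<Rightarrow> real" is "\<lambda>x. sqrt (\<Sum>n. (cmod (x n))\<^sup>2)" .

definition sgn_ell2 :: "ell2 \<Rightarrow> ell2" where
  "sgn_ell2 x = inverse (norm x) *\<^sub>R x"

definition dist_ell2 :: "ell2 \<Rightarrow> ell2 \<Rightarrow> real" where
  "dist_ell2 x y = norm (x - y)"

definition uniformity_ell2 :: "(ell2 \<times> ell2) filter" where
  "uniformity_ell2 = (INF e\<in>{0<..}. principal {(x, y). dist x y < e})"

definition open_ell2 :: "ell2 set \<Rightarrow> bool" where
  "open_ell2 U = (\<forall>x\<in>U. eventually (\<lambda>(x', y). x' = x \<longrightarrow> y \<in> U) uniformity)"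

instance
proof
  fix x y z :: ell2 and r s :: real and U :: "ell2 set"
  show "x + y + z = x + (y + z)" by transfer (simp add: add.assoc)
  show "x + y = y + x" by transfer (simp add: add.commute)
  show "0 + x = x" by transfer simp
  show "- x + x = 0" by transfer simp
  show "x - y = x + - y" by transfer simp
  show "r *\<^sub>R (x + y) = r *\<^sub>R x + r *\<^sub>R y" by transfer (simp add: scaleR_add_right)
  show "(r + s) *\<^sub>R x = r *\<^sub>R x + s *\<^sub>R x" by transfer (simp add: scaleR_add_left)
  show "r *\<^sub>R s *\<^sub>R x = (r * s) *\<^sub>R x" by transfer simp
  show "1 *\<^sub>R x = x" by transfer simp
  show "dist x y = norm (x - y)" by (rule dist_ell2_def)
  show "sgn x = inverse (norm x) *\<^sub>R x" by (rule sgn_ell2_def)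
  show "(uniformity :: (ell2 \<times> ell2) filter) = (INF e\<in>{0<..}. principal {(x, y). dist x y < e})"
    by (rule uniformity_ell2_def)
  show "open U \<longleftrightarrow> (\<forall>x\<in>U. eventually (\<lambda>(x', y). x' = x \<longrightarrow> y \<in> U) uniformity)"
    by (rule open_ell2_def)
  show "x \<bullet> y = y \<bullet> x" by transfer (simp add: inner_commute)
  show "(x + y) \<bullet> z = x \<bullet> z + y \<bullet> z"
    by transfer (simp add: inner_add_left suminf_add summable_inner_square)
  show "(r *\<^sub>R x) \<bullet> y = r * (x \<bullet> y)"
    by transfer (simp add: suminf_mult summable_inner_square)
  show "0 \<le> x \<bullet> x"
    by transfer (simp add: suminf_nonneg dot_square_norm)
  have inner_self_zero: "(\<Sum>n. x n \<bullet> x n) = 0 \<longleftrightarrow> x = (\<lambda>_. 0)"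
    if "summable (\<lambda>n. (cmod (x n))\<^sup>2)" for x :: "nat \<Rightarrow> complex"
  proof -
    have "(\<Sum>n. x n \<bullet> x n) = 0 \<longleftrightarrow> (\<forall>n. x n \<bullet> x n = 0)"
      by (rule suminf_eq_zero_iff) (rule summable_inner_square[OF that that], rule inner_ge_zero)
    then show ?thesis by (simp only: inner_eq_zero_iff fun_eq_iff)
  qed
  show "x \<bullet> x = 0 \<longleftrightarrow> x = 0"
    using inner_self_zero[of "ell2_nth x"] ell2_nth[of x]
    by (simp add: inner_ell2.rep_eq zero_ell2.rep_eq flip: ell2_nth_inject)
  show "norm x = sqrt (x \<bullet> x)"
    by transfer (simp add: dot_square_norm)
qed

end

lemma norm_cscale: "norm (cscale c x) = cmod c * norm x"
  by transfer (simp add: norm_mult power_mult_distrib suminf_mult real_sqrt_mult)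

lemma bounded_linear_cscale: "bounded_linear (cscale c)"
proof (rule bounded_linear_intro)
  show "cscale c (x + y) = cscale c x + cscale c y" for x y
    by transfer (simp add: distrib_left)
  show "cscale c (r *\<^sub>R x) = r *\<^sub>R cscale c x" for r x
    by transfer simp
  show "norm (cscale c x) \<le> norm x * cmod c" for x
    by (simp add: norm_cscale)
qed

lift_definition unit_vec :: "nat \<Rightarrow> ell2" is "\<lambda>k n. if n = k \<and> k \<ge> 1 then 1 else 0"
  subgoal for k by (intro conjI summable_finite[of "{k}"]) auto
  done

definition mat_entry :: "(ell2 \<Rightarrow>\<^sub>L ell2) \<Rightarrow> nat \<Rightarrow> nat \<Rightarrow> complex" where
  "mat_entry A m n = ell2_nth (blinfun_apply A (unit_vec n)) m"

text \<open>
  The type \<^typ>\<open>ell2 \<Rightarrow>\<^sub>L ell2\<close> consists of the bounded real-linear maps, with the operator norm;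
  the bounded operators are those of its elements that are complex-linear.
\<close>

definition bounded_ops :: "(ell2 \<Rightarrow>\<^sub>L ell2) set" where
  "bounded_ops = {A. \<forall>c x. blinfun_apply A (cscale c x) = cscale c (blinfun_apply A x)}"

definition compact_ops :: "(ell2 \<Rightarrow>\<^sub>L ell2) set" where
  "compact_ops = {A \<in> bounded_ops. compact (closure (blinfun_apply A ` cball 0 1))}"

definition helson :: "(ell2 \<Rightarrow>\<^sub>L ell2) \<Rightarrow> bool" where
  "helson A \<longleftrightarrow> (\<exists>\<rho> :: nat \<Rightarrow> complex. \<forall>m\<ge>1. \<forall>n\<ge>1. mat_entry A m n = \<rho> (m * n))"

definition bounded_helson :: "(ell2 \<Rightarrow>\<^sub>L ell2) set" where
  "bounded_helson = {A \<in> bounded_ops. helson A}"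

definition compact_helson :: "(ell2 \<Rightarrow>\<^sub>L ell2) set" where
  "compact_helson = {A \<in> compact_ops. helson A}"

definition cscale_op :: "complex \<Rightarrow> (ell2 \<Rightarrow>\<^sub>L ell2) \<Rightarrow> (ell2 \<Rightarrow>\<^sub>L ell2)" where
  "cscale_op c A = Blinfun (\<lambda>x. cscale c (blinfun_apply A x))"

lemma blinfun_apply_cscale_op: "blinfun_apply (cscale_op c A) x = cscale c (blinfun_apply A x)"
  unfolding cscale_op_def
  by (subst bounded_linear_Blinfun_apply)
    (simp_all add: bounded_linear_compose[OF bounded_linear_cscale] blinfun.bounded_linear_right)

text \<open>
  Here \<open>X\<close> is a complex-linear subspace of operators; only the values of \<open>Q\<close> on \<open>X\<close> matter.
\<close>

definition bounded_projection ::
  "(ell2 \<Rightarrow>\<^sub>L ell2) set \<Rightarrow> (ell2 \<Rightarrow>\<^sub>L ell2) set \<Rightarrow> ((ell2 \<Rightarrow>\<^sub>L ell2) \<Rightarrow> (ell2 \<Rightarrow>\<^sub>L ell2)) \<Rightarrow> bool"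
  where
  "bounded_projection X Y Q \<longleftrightarrow>
     (\<forall>A\<in>X. Q A \<in> X) \<and>
     (\<forall>A\<in>X. \<forall>B\<in>X. Q (A + B) = Q A + Q B) \<and>
     (\<forall>c. \<forall>A\<in>X. Q (cscale_op c A) = cscale_op c (Q A)) \<and>
     (\<exists>K. \<forall>A\<in>X. norm (Q A) \<le> K * norm A) \<and>
     (\<forall>A\<in>X. Q (Q A) = Q A) \<and>
     Q ` X = Y"

end

theory Submission
  imports Defs "HOL-Computational_Algebra.Primes" "HOL-Library.Infinite_Set"
begin

text \<open>
  Write \<open>E\<^sub>m\<^sub>n\<close> for the matrix units and \<open>q\<^sub>m\<^sub>n(k)\<close> for the common value of the entries of \<open>Q E\<^sub>m\<^sub>n\<close>
  at the positions \<open>(i, j)\<close> with \<open>i j = k\<close>. The set of Helson matrices is invariant under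
  \<open>A \<mapsto> D A D\<close> for the diagonal unitaries \<open>D = diag(n\<^sup>i\<^sup>t)\<close>. Averaging \<open>Q\<close> over this action
  leaves a projection of no larger norm that sends \<open>E\<^sub>m\<^sub>n\<close> to the Helson matrix with symbol
  \<open>c(m, n)\<close> at \<open>m n\<close> and \<open>0\<close> elsewhere, where \<open>c(m, n) = q\<^sub>m\<^sub>n(m n)\<close>. Only the bilinear forms of
  this averaged projection on finitely supported data are needed; they are controlled by
  \<open>averaged_projection_bound\<close>. The matrix with entries \<open>1\<close> where \<open>m n = k\<close> and \<open>0\<close> elsewhere is
  Helson and hence fixed by \<open>Q\<close>, so \<open>\<Sum>\<^bsub>m n = k\<^esub> c(m, n) = 1\<close> (\<open>sum_coeff_factorizations\<close>).

  The contradiction comes from weighing two kinds of factorizations against each other.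

  Nontrivial factorizations carry little weight. Take pairs \<open>(m\<^sub>l, n\<^sub>l)\<close> whose rows \<open>m\<^sub>l\<close>, columns
  \<open>n\<^sub>l\<close> and products are distinct for distinct \<open>l\<close>. Then \<open>\<Sum>\<^sub>l E\<^bsub>m\<^sub>l n\<^sub>l\<^esub>\<close> has norm at most \<open>1\<close>, while
  the first row of its averaged projection contains all the numbers \<open>c(m\<^sub>l, n\<^sub>l)\<close>. Therefore
  \<open>\<Sum>\<^sub>l \<bar>c(m\<^sub>l, n\<^sub>l)\<bar>\<^sup>2 \<le> K\<^sup>2\<close>, where \<open>K\<close> bounds the norm of \<open>Q\<close>. In an infinite family of
  pairwise coprime numbers there is thus, for each \<open>\<epsilon> > 0\<close>, a member \<open>N\<close> with
  \<open>\<bar>c(m, n)\<bar> \<le> \<epsilon>\<close> whenever \<open>m, n > 1\<close> and \<open>m n\<close> divides \<open>N\<close> (\<open>coeff_small_on_some\<close>).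

  The trivial factorizations cannot carry all the weight. Let \<open>N\<close> be such a number, a product of
  \<open>r\<close> distinct primes, with \<open>\<epsilon> = 2\<^sup>-\<^sup>r / 2\<close>. Then \<open>c(1, k) + c(k, 1)\<close> has real part at least
  \<open>1/2\<close> for every divisor \<open>k > 1\<close> of \<open>N\<close>. The matrix with ones at \<open>(1, k)\<close> and \<open>(k, 1)\<close> for
  \<open>k\<close> dividing \<open>N\<close> has norm at most \<open>sqrt (2 2\<^sup>r)\<close>. Its averaged projection has entries of real
  part at least \<open>1/2\<close> wherever \<open>m n\<close> divides \<open>N\<close>, that is at \<open>3\<^sup>r\<close> positions, and is zero at all
  the others. Testing it against the all-ones vector on the \<open>2\<^sup>r\<close> divisors of \<open>N\<close> gives
  \<open>3\<^sup>r / 2 \<le> K sqrt (2 2\<^sup>r) 2\<^sup>r\<close>, which fails for large \<open>r\<close> because \<open>3 > 2 sqrt 2\<close>.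

  Nothing in this argument distinguishes compact from bounded operators: it runs in any space of
  bounded operators that is closed under addition and complex scaling and contains the matrix
  units (\<open>no_bounded_projection_onto_helson\<close>).
\<close>

section \<open>Finitely supported vectors and matrices\<close>

lemma ell2_nth_0 [simp]: "ell2_nth x 0 = 0"
  using ell2_nth[of x] by simp

lemma summable_ell2_nth: "summable (\<lambda>n. (cmod (ell2_nth x n))\<^sup>2)"
  using ell2_nth[of x] by simp

lemma ell2_eqI: "(\<And>n. n \<ge> 1 \<Longrightarrow> ell2_nth x n = ell2_nth y n) \<Longrightarrow> x = y"
  by (metis ell2_nth_0 ell2_nth_inject ext less_one linorder_not_le)

lemma ell2_nth_unit_vec: "ell2_nth (unit_vec k) n = (if n = k \<and> k \<ge> 1 then 1 else 0)"
  by transfer simp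

lemma ell2_nth_sum: "ell2_nth (sum f S) n = (\<Sum>i\<in>S. ell2_nth (f i) n)"
  by (induction S rule: infinite_finite_induct)
    (simp_all add: zero_ell2.rep_eq plus_ell2.rep_eq)

lemma norm_ell2_square: "(norm x)\<^sup>2 = (\<Sum>n. (cmod (ell2_nth x n))\<^sup>2)"
  by (simp add: norm_ell2.rep_eq suminf_nonneg summable_ell2_nth)

lemma sum_square_le_norm:
  assumes "finite S"
  shows "(\<Sum>n\<in>S. (cmod (ell2_nth x n))\<^sup>2) \<le> (norm x)\<^sup>2"
  unfolding norm_ell2_square by (rule sum_le_suminf[OF summable_ell2_nth assms]) simp

lemma norm_square_finite_support:
  assumes "finite S" "\<And>n. n \<notin> S \<Longrightarrow> ell2_nth x n = 0"
  shows "(norm x)\<^sup>2 = (\<Sum>n\<in>S. (cmod (ell2_nth x n))\<^sup>2)"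
  unfolding norm_ell2_square using assms by (intro suminf_finite) auto

lemma cmod_ell2_nth_le: "cmod (ell2_nth x n) \<le> norm x"
  using sum_square_le_norm[of "{n}" x] by (simp add: power2_le_iff_abs_le)

lemma bounded_linear_ell2_nth: "bounded_linear (\<lambda>x. ell2_nth x n)"
  by (rule bounded_linear_intro[of _ 1])
    (simp_all add: plus_ell2.rep_eq scaleR_ell2.rep_eq cmod_ell2_nth_le)

lemma bounded_linear_cscale_left: "bounded_linear (\<lambda>c. cscale c y)"
proof (rule bounded_linear_intro)
  show "cscale (c + d) y = cscale c y + cscale d y" for c d
    by transfer (simp add: distrib_right)
  show "cscale (r *\<^sub>R c) y = r *\<^sub>R cscale c y" for r c
    by transfer simp
  show "norm (cscale c y) \<le> norm c * norm y" for c
    by (simp add: norm_cscale)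
qed

definition finite_vec :: "(nat \<Rightarrow> complex) \<Rightarrow> nat set \<Rightarrow> ell2" where
  "finite_vec u G = (\<Sum>n\<in>G. cscale (u n) (unit_vec n))"

lemma norm_finite_vec:
  assumes "finite G" "0 \<notin> G"
  shows "norm (finite_vec u G) = sqrt (\<Sum>n\<in>G. (cmod (u n))\<^sup>2)"
proof -
  have nth: "ell2_nth (finite_vec u G) k = (\<Sum>n\<in>G. if k = n then u n else 0)" for k
    unfolding finite_vec_def ell2_nth_sum using assms(2)
    by (intro sum.cong) (auto simp: cscale.rep_eq ell2_nth_unit_vec Suc_le_eq intro: gr0I)
  have "(norm (finite_vec u G))\<^sup>2 = (\<Sum>n\<in>G. (cmod (u n))\<^sup>2)"
    using assms by (subst norm_square_finite_support[of G]) (auto simp: nth)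
  then show ?thesis
    by (metis norm_ge_zero real_sqrt_abs abs_of_nonneg)
qed

definition matrix_unit :: "nat \<Rightarrow> nat \<Rightarrow> ell2 \<Rightarrow>\<^sub>L ell2" where
  "matrix_unit m n = Blinfun (\<lambda>x. cscale (ell2_nth x n) (unit_vec m))"

lemma matrix_unit_apply:
  "blinfun_apply (matrix_unit m n) x = cscale (ell2_nth x n) (unit_vec m)"
  unfolding matrix_unit_def
  by (subst bounded_linear_Blinfun_apply)
    (auto intro: bounded_linear_compose[OF bounded_linear_cscale_left bounded_linear_ell2_nth])

lemma mat_entry_matrix_unit:
  "mat_entry (matrix_unit m n) i j = (if i = m \<and> j = n \<and> m \<ge> 1 \<and> n \<ge> 1 then 1 else 0)"
  by (auto simp: mat_entry_def matrix_unit_apply cscale.rep_eq ell2_nth_unit_vec)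

lemma mat_entry_add: "mat_entry (A + B) m n = mat_entry A m n + mat_entry B m n"
  by (simp add: mat_entry_def blinfun.add_left plus_ell2.rep_eq)

lemma mat_entry_0: "mat_entry 0 m n = 0"
  by (simp add: mat_entry_def zero_ell2.rep_eq)

lemma mat_entry_cscale_op: "mat_entry (cscale_op c A) m n = c * mat_entry A m n"
  by (simp add: mat_entry_def blinfun_apply_cscale_op cscale.rep_eq)

lemma mat_entry_sum: "mat_entry (sum f S) m n = (\<Sum>i\<in>S. mat_entry (f i) m n)"
  by (induction S rule: infinite_finite_induct) (simp_all add: mat_entry_add mat_entry_0)

lemma bilinear_form_bound:
  assumes A: "A \<in> bounded_ops"
    and G: "finite G" "0 \<notin> G" and H: "finite H" "0 \<notin> H"
  shows "cmod (\<Sum>m\<in>G. \<Sum>n\<in>H. mat_entry A m n * u n * v m)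
    \<le> norm A * sqrt (\<Sum>n\<in>H. (cmod (u n))\<^sup>2) * sqrt (\<Sum>m\<in>G. (cmod (v m))\<^sup>2)"
proof -
  define y where "y = blinfun_apply A (finite_vec u H)"
  have nth: "ell2_nth y m = (\<Sum>n\<in>H. mat_entry A m n * u n)" for m
    using A unfolding y_def finite_vec_def bounded_ops_def
    by (simp add: blinfun.sum_right ell2_nth_sum cscale.rep_eq mat_entry_def mult.commute)
  have "cmod (\<Sum>m\<in>G. \<Sum>n\<in>H. mat_entry A m n * u n * v m) = cmod (\<Sum>m\<in>G. ell2_nth y m * v m)"
    by (simp add: nth sum_distrib_right)
  also have "\<dots> \<le> (\<Sum>m\<in>G. \<bar>cmod (ell2_nth y m)\<bar> * \<bar>cmod (v m)\<bar>)"
    by (rule order_trans[OF norm_sum]) (simp add: norm_mult)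
  also have "\<dots> \<le> L2_set (\<lambda>m. cmod (ell2_nth y m)) G * L2_set (\<lambda>m. cmod (v m)) G"
    by (rule L2_set_mult_ineq)
  also have "\<dots> \<le> norm y * sqrt (\<Sum>m\<in>G. (cmod (v m))\<^sup>2)"
    unfolding L2_set_def
    by (intro mult_right_mono real_le_lsqrt sum_square_le_norm G) (auto intro: sum_nonneg)
  also have "\<dots> \<le> (norm A * sqrt (\<Sum>n\<in>H. (cmod (u n))\<^sup>2)) * sqrt (\<Sum>m\<in>G. (cmod (v m))\<^sup>2)"
    unfolding y_def norm_finite_vec[OF H, symmetric]
    by (intro mult_right_mono norm_blinfun) (auto intro: sum_nonneg)
  finally show ?thesis .
qed

text \<open>
  Finitely supported matrices, given by a set of positions and a weight for each. The norm bounds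
  below hold uniformly over all weights of modulus at most \<open>1\<close>, so they survive multiplication
  of the entries by unimodular phases.
\<close>

definition weighted_matrix :: "(nat \<times> nat) set \<Rightarrow> (nat \<Rightarrow> nat \<Rightarrow> complex) \<Rightarrow> ell2 \<Rightarrow>\<^sub>L ell2" where
  "weighted_matrix F w = (\<Sum>(m, n)\<in>F. cscale_op (w m n) (matrix_unit m n))"

lemma weighted_matrix_apply_nth:
  assumes "finite F"
  shows "ell2_nth (blinfun_apply (weighted_matrix F w) x) m
    = (if m \<ge> 1 then \<Sum>n\<in>F `` {m}. w m n * ell2_nth x n else 0)"
proof -
  have "ell2_nth (blinfun_apply (weighted_matrix F w) x) m
      = (\<Sum>p\<in>F. if fst p = m \<and> m \<ge> 1 then w m (snd p) * ell2_nth x (snd p) else 0)"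
    unfolding weighted_matrix_def
    by (auto simp: blinfun.sum_left ell2_nth_sum blinfun_apply_cscale_op matrix_unit_apply
      cscale.rep_eq ell2_nth_unit_vec intro!: sum.cong)
  also have "\<dots> = (\<Sum>p\<in>{p\<in>F. fst p = m \<and> m \<ge> 1}. w m (snd p) * ell2_nth x (snd p))"
    using assms by (simp add: sum.inter_filter)
  also have "\<dots> = (if m \<ge> 1 then \<Sum>n\<in>F `` {m}. w m n * ell2_nth x n else 0)"
  proof (cases "m \<ge> 1")
    case True
    then show ?thesis
      by (auto intro!: sum.reindex_bij_witness[of _ "\<lambda>n. (m, n)" snd])
  qed auto
  finally show ?thesis .
qed

text \<open>
  Cauchy-Schwarz in each row. Both norm bounds below are special cases: for general positions the
  squared Frobenius norm appears, and for at most one position per row and column the bound is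
  \<open>1\<close>.
\<close>

lemma norm_weighted_matrix_apply_le:
  assumes F: "finite F" and w: "\<And>m n. cmod (w m n) \<le> 1"
  shows "(norm (blinfun_apply (weighted_matrix F w) x))\<^sup>2
    \<le> (\<Sum>m\<in>fst ` F. real (card (F `` {m})) * (\<Sum>n\<in>F `` {m}. (cmod (ell2_nth x n))\<^sup>2))"
proof -
  let ?y = "blinfun_apply (weighted_matrix F w) x"
  have "F `` {m} = {}" if "m \<notin> fst ` F" for m
    using that by force
  then have "(norm ?y)\<^sup>2 = (\<Sum>m\<in>fst ` F. (cmod (ell2_nth ?y m))\<^sup>2)"
    using F by (intro norm_square_finite_support) (auto simp: weighted_matrix_apply_nth)
  also have "\<dots> \<le> (\<Sum>m\<in>fst ` F. real (card (F `` {m})) * (\<Sum>n\<in>F `` {m}. (cmod (ell2_nth x n))\<^sup>2))"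
  proof (rule sum_mono)
    fix m
    have "cmod (ell2_nth ?y m) \<le> (\<Sum>n\<in>F `` {m}. cmod (w m n * ell2_nth x n))"
      using F by (auto simp: weighted_matrix_apply_nth intro: norm_sum sum_nonneg)
    also have "\<dots> \<le> (\<Sum>n\<in>F `` {m}. 1 * cmod (ell2_nth x n))"
      unfolding norm_mult by (intro sum_mono mult_right_mono w) auto
    finally have "(cmod (ell2_nth ?y m))\<^sup>2 \<le> (\<Sum>n\<in>F `` {m}. 1 * cmod (ell2_nth x n))\<^sup>2"
      by (intro power_mono) auto
    also have "\<dots> \<le> (\<Sum>n\<in>F `` {m}. 1\<^sup>2) * (\<Sum>n\<in>F `` {m}. (cmod (ell2_nth x n))\<^sup>2)"
      by (rule Cauchy_Schwarz_ineq_sum)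
    finally show "(cmod (ell2_nth ?y m))\<^sup>2
        \<le> real (card (F `` {m})) * (\<Sum>n\<in>F `` {m}. (cmod (ell2_nth x n))\<^sup>2)"
      by simp
  qed
  finally show ?thesis .
qed

lemma norm_weighted_matrix_le_Frobenius:
  assumes F: "finite F" and w: "\<And>m n. cmod (w m n) \<le> 1"
  shows "norm (weighted_matrix F w) \<le> sqrt (card F)"
proof (rule norm_blinfun_bound)
  fix x
  have "F = Sigma (fst ` F) (\<lambda>m. F `` {m})"
    by force
  moreover have "card (Sigma (fst ` F) (\<lambda>m. F `` {m})) = (\<Sum>m\<in>fst ` F. card (F `` {m}))"
    using F by (intro card_SigmaI) auto
  ultimately have card: "card F = (\<Sum>m\<in>fst ` F. card (F `` {m}))"
    by simp
  have "(norm (blinfun_apply (weighted_matrix F w) x))\<^sup>2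
      \<le> (\<Sum>m\<in>fst ` F. real (card (F `` {m})) * (\<Sum>n\<in>F `` {m}. (cmod (ell2_nth x n))\<^sup>2))"
    by (rule norm_weighted_matrix_apply_le[OF assms])
  also have "\<dots> \<le> (\<Sum>m\<in>fst ` F. real (card (F `` {m})) * (norm x)\<^sup>2)"
    using F by (intro sum_mono mult_left_mono sum_square_le_norm) auto
  also have "\<dots> = (sqrt (card F) * norm x)\<^sup>2"
    by (simp add: card sum_distrib_right power_mult_distrib sum_nonneg)
  finally show "norm (blinfun_apply (weighted_matrix F w) x) \<le> sqrt (card F) * norm x"
    by (rule power2_le_imp_le) simp
qed simp

lemma norm_weighted_matrix_le_matching:
  assumes F: "finite F" and w: "\<And>m n. cmod (w m n) \<le> 1"
    and inj: "inj_on fst F" "inj_on snd F"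
  shows "norm (weighted_matrix F w) \<le> 1"
proof (rule norm_blinfun_bound)
  fix x
  have row: "F `` {fst p} = {snd p}" if "p \<in> F" for p
  proof -
    have "n = snd p" if "(fst p, n) \<in> F" for n
      using inj_onD[OF inj(1) _ that \<open>p \<in> F\<close>] by (cases p) simp
    then show ?thesis
      using that by auto
  qed
  have "(norm (blinfun_apply (weighted_matrix F w) x))\<^sup>2
      \<le> (\<Sum>m\<in>fst ` F. real (card (F `` {m})) * (\<Sum>n\<in>F `` {m}. (cmod (ell2_nth x n))\<^sup>2))"
    by (rule norm_weighted_matrix_apply_le[OF F w])
  also have "\<dots> = (\<Sum>n\<in>snd ` F. (cmod (ell2_nth x n))\<^sup>2)"
    by (simp add: sum.reindex inj row)
  also have "\<dots> \<le> (1 * norm x)\<^sup>2"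
    using F by (simp add: sum_square_le_norm)
  finally show "norm (blinfun_apply (weighted_matrix F w) x) \<le> 1 * norm x"
    by (rule power2_le_imp_le) simp
qed simp

section \<open>Averaging over unimodular phases\<close>

text \<open>
  The mean of the powers of a unimodular number detects whether that number is \<open>1\<close>. Through
  this, a bound on trigonometric sums that is uniform in \<open>t\<close> passes to the part with constant
  phase.
\<close>

lemma phase_average_tendsto:
  fixes z :: complex
  assumes "cmod z = 1"
  shows "(\<lambda>T. (\<Sum>t<T. z ^ t) / of_nat T) \<longlonglongrightarrow> (if z = 1 then 1 else 0)"
proof (cases "z = 1")
  case True
  have "\<forall>\<^sub>F T in sequentially. (1::complex) = (\<Sum>t<T. z ^ t) / of_nat T"
    using eventually_gt_at_top[of 0] by eventually_elim (simp add: True)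
  then show ?thesis
    using True by (auto intro: Lim_transform_eventually[OF tendsto_const])
next
  case False
  have "(\<lambda>T. (\<Sum>t<T. z ^ t) / of_nat T) \<longlonglongrightarrow> 0"
  proof (rule Lim_null_comparison)
    show "\<forall>\<^sub>F T in sequentially. norm ((\<Sum>t<T. z ^ t) / of_nat T) \<le> 2 / cmod (1 - z) / real T"
    proof (rule eventuallyI)
      fix T
      have "cmod (1 - z ^ T) \<le> 2"
        using norm_triangle_ineq4[of 1 "z ^ T"] by (simp add: norm_power assms)
      then have "cmod (\<Sum>t<T. z ^ t) \<le> 2 / cmod (1 - z)"
        using False by (simp add: sum_gp_strict norm_divide divide_right_mono)
      then have "cmod (\<Sum>t<T. z ^ t) / real T \<le> 2 / cmod (1 - z) / real T"
        by (rule divide_right_mono) simp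
      then show "norm ((\<Sum>t<T. z ^ t) / of_nat T) \<le> 2 / cmod (1 - z) / real T"
        by (simp add: norm_divide)
    qed
    show "(\<lambda>T. 2 / cmod (1 - z) / real T) \<longlonglongrightarrow> 0"
      by (rule lim_const_over_n)
  qed
  then show ?thesis using False by simp
qed

lemma constant_phase_part_bound:
  fixes b z :: "'i \<Rightarrow> complex"
  assumes "finite I" and z: "\<And>i. i \<in> I \<Longrightarrow> cmod (z i) = 1"
    and bound: "\<And>t::nat. cmod (\<Sum>i\<in>I. b i * z i ^ t) \<le> C"
  shows "cmod (\<Sum>i\<in>I. if z i = 1 then b i else 0) \<le> C"
proof -
  define S where "S t = (\<Sum>i\<in>I. b i * z i ^ t)" for t :: nat
  have "(\<lambda>T. \<Sum>i\<in>I. b i * ((\<Sum>t<T. z i ^ t) / of_nat T))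
      \<longlonglongrightarrow> (\<Sum>i\<in>I. b i * (if z i = 1 then 1 else 0))"
    by (intro tendsto_sum tendsto_mult tendsto_const phase_average_tendsto z)
  moreover have "(\<Sum>i\<in>I. b i * ((\<Sum>t<T. z i ^ t) / of_nat T)) = (\<Sum>t<T. S t) / of_nat T" for T
    unfolding S_def sum_divide_distrib sum_distrib_left
    by (subst sum.swap) simp
  moreover have "(\<Sum>i\<in>I. b i * (if z i = 1 then 1 else 0)) = (\<Sum>i\<in>I. if z i = 1 then b i else 0)"
    by (intro sum.cong) auto
  ultimately have lim: "(\<lambda>T. (\<Sum>t<T. S t) / of_nat T) \<longlonglongrightarrow> (\<Sum>i\<in>I. if z i = 1 then b i else 0)"
    by simp
  have "cmod ((\<Sum>t<T. S t) / of_nat T) \<le> C" if "T > 0" for T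
  proof -
    have "cmod (\<Sum>t<T. S t) \<le> (\<Sum>t<T. C)"
      by (intro sum_norm_le) (simp add: S_def bound)
    then show ?thesis
      using that by (simp add: norm_divide field_simps)
  qed
  then have "\<forall>\<^sub>F T in sequentially. cmod ((\<Sum>t<T. S t) / of_nat T) \<le> C"
    by (rule eventually_mono[OF eventually_gt_at_top[of 0]])
  then show ?thesis
    using tendsto_norm[OF lim] by (intro tendsto_upperbound[of _ _ sequentially]) auto
qed

text \<open>
  The unimodular numbers \<open>cis (s * ln k)\<close> are multiplicative in \<open>k\<close> since \<open>ln\<close> is additive. For
  \<open>s\<close> small enough, all differences of the exponents up to \<open>M\<close> stay below \<open>2 * pi\<close>, so that
  distinct integers get distinct phases.
\<close>

lemma separating_phase:
  fixes M :: nat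
  obtains s :: real where
    "\<And>j k. j \<in> {1..M} \<Longrightarrow> k \<in> {1..M} \<Longrightarrow> cis (s * (ln (real j) - ln (real k))) = 1 \<longleftrightarrow> j = k"
proof
  define s where "s = 1 / (1 + ln (real (Suc M)))"
  fix j k assume jk: "j \<in> {1..M}" "k \<in> {1..M}"
  let ?d = "ln (real j) - ln (real k)"
  have "0 \<le> ln (real j)" "0 \<le> ln (real k)" "ln (real j) \<le> ln (real (Suc M))"
    "ln (real k) \<le> ln (real (Suc M))"
    using jk by auto
  then have "\<bar>?d\<bar> < 1 + ln (real (Suc M))" and s: "s > 0"
    by (auto simp: s_def)
  then have "\<bar>s * ?d\<bar> < 1"
    by (simp add: s_def abs_mult)
  then have small: "\<bar>s * ?d\<bar> < 2 * pi"
    using pi_gt3 by linarith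
  show "cis (s * ?d) = 1 \<longleftrightarrow> j = k"
  proof
    assume "cis (s * ?d) = 1"
    then have "cos (s * ?d) = 1"
      by (simp add: complex_eq_iff)
    then obtain i :: int where i: "s * ?d = of_int i * 2 * pi"
      using cos_one_2pi_int by blast
    then have "\<bar>real_of_int i\<bar> * (2 * pi) < 1 * (2 * pi)"
      using small by (simp add: abs_mult mult.assoc)
    then have "i = 0"
      using mult_less_cancel_right_pos[of "2*pi" "\<bar>real_of_int i\<bar>" 1] pi_gt_zero by linarith
    then have "?d = 0"
      using i s by simp
    then show "j = k"
      using jk by simp
  qed simp
qed

section \<open>Projections onto Helson matrices and their coefficients\<close>

lemma cscale_op_0: "cscale_op 0 A = 0"
  by (rule blinfun_eqI) (auto simp: blinfun_apply_cscale_op cscale.rep_eq zero_ell2.rep_eq intro: ell2_eqI)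

lemma helson_mat_entry:
  assumes "helson A" "m \<ge> 1" "n \<ge> 1"
  shows "mat_entry A m n = mat_entry A 1 (m * n)"
  using assms unfolding helson_def
  by (metis One_nat_def Suc_le_eq mult_1 nat_0_less_mult_iff order_refl)

text \<open>
  Compact and bounded operators are treated together: \<open>X\<close> stands for either space. The locale is
  inconsistent, and everything proved in it is a step towards that contradiction.
\<close>

locale helson_projection =
  fixes X :: "(ell2 \<Rightarrow>\<^sub>L ell2) set" and Q :: "(ell2 \<Rightarrow>\<^sub>L ell2) \<Rightarrow> (ell2 \<Rightarrow>\<^sub>L ell2)" and K :: real
  assumes X_bounded: "X \<subseteq> bounded_ops"
    and X_add: "\<And>A B. A \<in> X \<Longrightarrow> B \<in> X \<Longrightarrow> A + B \<in> X"
    and X_cscale: "\<And>c A. A \<in> X \<Longrightarrow> cscale_op c A \<in> X"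
    and X_unit: "\<And>m n. matrix_unit m n \<in> X"
    and Q_X: "\<And>A. A \<in> X \<Longrightarrow> Q A \<in> X"
    and Q_add: "\<And>A B. A \<in> X \<Longrightarrow> B \<in> X \<Longrightarrow> Q (A + B) = Q A + Q B"
    and Q_cscale: "\<And>c A. A \<in> X \<Longrightarrow> Q (cscale_op c A) = cscale_op c (Q A)"
    and Q_bound: "\<And>A. A \<in> X \<Longrightarrow> norm (Q A) \<le> K * norm A"
    and K_nonneg: "0 \<le> K"
    and Q_helson: "\<And>A. A \<in> X \<Longrightarrow> helson (Q A)"
    and Q_fix: "\<And>A. A \<in> X \<Longrightarrow> helson A \<Longrightarrow> Q A = A"
begin

text \<open>
  A Helson matrix is determined by its first row, so this is the entry of \<open>Q (matrix_unit m n)\<close>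
  at every position whose product is \<open>m * n\<close>, and in particular at \<open>(m, n)\<close> itself. It is the only
  part of \<open>Q (matrix_unit m n)\<close> that survives the averaging.
\<close>

definition coeff :: "nat \<Rightarrow> nat \<Rightarrow> complex" where
  "coeff m n = mat_entry (Q (matrix_unit m n)) 1 (m * n)"

lemma X_0: "0 \<in> X"
  using X_cscale[OF X_unit, of 0] by (simp add: cscale_op_0)

lemma Q_0: "Q 0 = 0"
  using Q_cscale[OF X_0, of 0] by (simp add: cscale_op_0)

lemma weighted_matrix_in_X: "finite F \<Longrightarrow> weighted_matrix F w \<in> X"
  unfolding weighted_matrix_def
  by (induction F rule: finite_induct) (auto simp: X_0 X_add X_cscale X_unit)

lemma Q_weighted_matrix:
  assumes "finite F"
  shows "Q (weighted_matrix F w) = (\<Sum>(m, n)\<in>F. cscale_op (w m n) (Q (matrix_unit m n)))"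
  using assms
proof (induction F rule: finite_induct)
  case empty
  then show ?case by (simp add: weighted_matrix_def Q_0)
next
  case (insert p F)
  then have "weighted_matrix (insert p F) w
      = cscale_op (w (fst p) (snd p)) (matrix_unit (fst p) (snd p)) + weighted_matrix F w"
    by (simp add: weighted_matrix_def case_prod_unfold)
  then show ?case
    using insert by (simp add: Q_add Q_cscale X_cscale X_unit weighted_matrix_in_X case_prod_unfold)
qed

lemma mat_entry_Q_weighted_matrix:
  "finite F \<Longrightarrow> mat_entry (Q (weighted_matrix F w)) i j
    = (\<Sum>(m, n)\<in>F. w m n * mat_entry (Q (matrix_unit m n)) i j)"
  by (simp add: Q_weighted_matrix mat_entry_sum mat_entry_cscale_op case_prod_unfold)

text \<open>
  Here \<open>g\<close> is the symbol of the averaged projection of the matrix with ones on \<open>F\<close>. Multiplying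
  the entry at \<open>(m, n)\<close> by the phase of \<open>m * n\<close> and the test vectors by the opposite phases
  changes no norm, whereas in the bilinear form the contribution of \<open>(m, n)\<close> to position \<open>(i, j)\<close>
  acquires the phase of \<open>m * n\<close> divided by that of \<open>i * j\<close>. Averaging leaves the
  contributions with \<open>m * n = i * j\<close>.
\<close>

lemma averaged_projection_bound:
  fixes F :: "(nat \<times> nat) set" and u v :: "nat \<Rightarrow> complex"
  defines "g \<equiv> \<lambda>k. \<Sum>(m, n)\<in>F. if m * n = k then coeff m n else 0"
  assumes F: "finite F" "F \<subseteq> {1..} \<times> {1..}"
    and G: "finite G" "0 \<notin> G" and H: "finite H" "0 \<notin> H"
    and B: "\<And>w. (\<And>m n. cmod (w m n) \<le> 1) \<Longrightarrow> norm (weighted_matrix F w) \<le> B"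
  shows "cmod (\<Sum>m\<in>G. \<Sum>n\<in>H. g (m * n) * u n * v m)
    \<le> K * B * sqrt (\<Sum>n\<in>H. (cmod (u n))\<^sup>2) * sqrt (\<Sum>m\<in>G. (cmod (v m))\<^sup>2)"
    (is "_ \<le> ?C")
proof -
  let ?P = "(\<lambda>(m, n). m * n) ` (F \<union> G \<times> H)"
  have "finite ?P"
    using F G H by simp
  then obtain M where "\<forall>k\<in>?P. k \<le> M"
    using finite_nat_set_iff_bounded_le by blast
  then have leM: "m * n \<in> {1..M}" if "(m, n) \<in> F \<union> G \<times> H" for m n
  proof -
    have "m * n \<le> M"
      using \<open>\<forall>k\<in>?P. k \<le> M\<close> that by force
    moreover have "m \<noteq> 0" "n \<noteq> 0"
      using that F(2) G(2) H(2) by (auto intro: gr0I)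
    ultimately show ?thesis by simp
  qed
  obtain s where s: "\<And>j k. j \<in> {1..M} \<Longrightarrow> k \<in> {1..M} \<Longrightarrow>
      cis (s * (ln (real j) - ln (real k))) = 1 \<longleftrightarrow> j = k"
    using separating_phase by blast
  let ?q = "\<lambda>m n k. mat_entry (Q (matrix_unit m n)) 1 k"
  define b where "b = (\<lambda>((m, n), i, j). ?q m n (i * j) * u j * v i)"
  define z where "z = (\<lambda>((m::nat, n::nat), i::nat, j::nat).
    cis (s * (ln (real (m * n)) - ln (real (i * j)))))"
  have "cmod (\<Sum>x\<in>F \<times> (G \<times> H). b x * z x ^ t) \<le> ?C" for t
  proof -
    \<comment> \<open>The phases of the entries, and the opposite phases \<open>\<phi>\<close> for the test vectors.\<close>
    define w where "w m n = cis (s * ln (real (m * n))) ^ t" for m n :: nat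
    define \<phi> where "\<phi> n = cis (- (s * ln (real n))) ^ t" for n :: nat
    define A where "A = weighted_matrix F w"
    have A: "A \<in> X" "norm A \<le> B"
      using F by (auto simp: A_def w_def norm_power intro: weighted_matrix_in_X B)
    have summand: "w m n * ?q m n (i * j) * (u j * \<phi> j) * (v i * \<phi> i) = b ((m, n), i, j) * z ((m, n), i, j) ^ t"
      if "i \<in> G" "j \<in> H" for m n i j
    proof -
      have pos: "real i > 0" "real j > 0"
        using that G H by (auto intro: gr0I)
      have "w m n * \<phi> j * \<phi> i = z ((m, n), i, j) ^ t"
        using pos unfolding w_def \<phi>_def z_def
        by (simp add: power_mult_distrib[symmetric] cis_mult ln_mult algebra_simps)
      then show ?thesis
        by (simp add: b_def algebra_simps)
    qed
    have "(\<Sum>x\<in>F \<times> (G \<times> H). b x * z x ^ t)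
        = (\<Sum>i\<in>G. \<Sum>j\<in>H. \<Sum>p\<in>F. b (p, i, j) * z (p, i, j) ^ t)"
      by (simp add: sum.cartesian_product' sum.swap[of _ F] case_prod_unfold)
    also have "\<dots> = (\<Sum>i\<in>G. \<Sum>j\<in>H. mat_entry (Q A) i j * (u j * \<phi> j) * (v i * \<phi> i))"
    proof (intro sum.cong refl)
      fix i j assume ij: "i \<in> G" "j \<in> H"
      then have "i \<ge> 1" "j \<ge> 1"
        using G H by (auto simp: Suc_le_eq intro: gr0I)
      then have "mat_entry (Q A) i j = mat_entry (Q A) 1 (i * j)"
        using Q_helson[OF A(1)] helson_mat_entry by blast
      then show "(\<Sum>p\<in>F. b (p, i, j) * z (p, i, j) ^ t)
          = mat_entry (Q A) i j * (u j * \<phi> j) * (v i * \<phi> i)"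
        using F(1) unfolding A_def
        by (auto simp: mat_entry_Q_weighted_matrix sum_distrib_right summand[OF ij, symmetric]
          intro!: sum.cong)
    qed
    finally have "cmod (\<Sum>x\<in>F \<times> (G \<times> H). b x * z x ^ t)
        \<le> norm (Q A) * sqrt (\<Sum>n\<in>H. (cmod (u n * \<phi> n))\<^sup>2) * sqrt (\<Sum>m\<in>G. (cmod (v m * \<phi> m))\<^sup>2)"
      using bilinear_form_bound[OF _ G H, of "Q A"] Q_X[OF A(1)] X_bounded by auto
    also have "\<dots> = norm (Q A) * sqrt (\<Sum>n\<in>H. (cmod (u n))\<^sup>2) * sqrt (\<Sum>m\<in>G. (cmod (v m))\<^sup>2)"
      by (simp add: \<phi>_def norm_mult norm_power)
    also have "\<dots> \<le> ?C"
      using A order_trans[OF Q_bound[OF A(1)] mult_left_mono[OF A(2) K_nonneg]]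
      by (intro mult_right_mono) (auto intro: sum_nonneg)
    finally show ?thesis .
  qed
  moreover have "cmod (z x) = 1" for x
    by (simp add: z_def case_prod_unfold)
  ultimately have "cmod (\<Sum>x\<in>F \<times> (G \<times> H). if z x = 1 then b x else 0) \<le> ?C"
    using F G H by (intro constant_phase_part_bound) auto
  also have "(\<Sum>x\<in>F \<times> (G \<times> H). if z x = 1 then b x else 0)
      = (\<Sum>i\<in>G. \<Sum>j\<in>H. \<Sum>p\<in>F. if z (p, i, j) = 1 then b (p, i, j) else 0)"
    by (simp add: sum.cartesian_product' sum.swap[of _ F] case_prod_unfold)
  also have "\<dots> = (\<Sum>i\<in>G. \<Sum>j\<in>H. g (i * j) * u j * v i)"
  proof (intro sum.cong refl)
    fix i j assume ij: "i \<in> G" "j \<in> H"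
    have "z ((m, n), i, j) = 1 \<longleftrightarrow> m * n = i * j" if "(m, n) \<in> F" for m n
      using s[OF leM leM, of m n i j] that ij by (simp add: z_def)
    then show "(\<Sum>p\<in>F. if z (p, i, j) = 1 then b (p, i, j) else 0) = g (i * j) * u j * v i"
      unfolding g_def sum_distrib_right by (intro sum.cong) (auto simp: b_def coeff_def)
  qed
  finally show ?thesis .
qed

text \<open>
  The matrix with ones at the positions of product \<open>k\<close> is itself Helson, hence fixed by the
  projection; the equation compares its symbol at \<open>k\<close> before and after.
\<close>

lemma sum_coeff_factorizations:
  assumes "k > 0"
  shows "(\<Sum>(m, n)\<in>{(m, n). m * n = k}. coeff m n) = 1"
proof -
  let ?F = "{(m, n). m * n = k}"
  let ?A = "weighted_matrix ?F (\<lambda>_ _. 1)"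
  have "?F \<subseteq> {..k} \<times> {..k}"
    using assms by (auto intro: dvd_imp_le)
  then have F: "finite ?F"
    by (rule finite_subset) simp
  have entry: "mat_entry ?A i j = (if i * j = k then 1 else 0)" if "i \<ge> 1" "j \<ge> 1" for i j
  proof -
    have "mat_entry ?A i j = (\<Sum>p\<in>?F. if p = (i, j) then 1 else 0)"
      unfolding weighted_matrix_def mat_entry_sum using that
      by (intro sum.cong) (auto simp: mat_entry_cscale_op mat_entry_matrix_unit split: if_splits)
    then show ?thesis
      using F by simp
  qed
  have "helson ?A"
    unfolding helson_def by (rule exI[of _ "\<lambda>l. if l = k then 1 else 0"]) (simp add: entry)
  then have "Q ?A = ?A"
    using F by (intro Q_fix weighted_matrix_in_X)
  then have "mat_entry (Q ?A) 1 k = 1"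
    using entry[of 1 k] assms by simp
  moreover have "mat_entry (Q ?A) 1 k = (\<Sum>(m, n)\<in>?F. coeff m n)"
    by (auto simp: mat_entry_Q_weighted_matrix[OF F] coeff_def intro!: sum.cong)
  ultimately show ?thesis by simp
qed

end

section \<open>Factorizations of squarefree numbers\<close>

text \<open>
  Each prime divides at most one of \<open>m\<close> and \<open>n\<close> when \<open>m * n\<close> divides a squarefree number, which
  leaves three choices per prime for a pair and two for a single divisor.
\<close>

lemma card_divisors_prod_primes:
  fixes P :: "nat set"
  assumes "finite P" "\<And>p. p \<in> P \<Longrightarrow> prime p"
  shows "card {d. d dvd \<Prod>P} = 2 ^ card P"
    and "card {(m, n). m * n dvd \<Prod>P} = 3 ^ card P"
proof -
  have "card {d. d dvd \<Prod>P} = 2 ^ card P \<and> card {(m, n). m * n dvd \<Prod>P} = 3 ^ card P"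
    using assms
  proof (induction P rule: finite_induct)
    case empty
    have "{(m, n). m * n dvd (1::nat)} = {(1, 1)}"
      by auto
    then show ?case by simp
  next
    case (insert p P)
    define M where "M = \<Prod>P"
    have p: "prime p" and M: "M > 0" and prod: "\<Prod>(insert p P) = p * M"
      using insert by (auto simp: M_def intro!: prod_pos prime_gt_0_nat)
    have "\<not> p dvd M"
    proof
      assume "p dvd M"
      then obtain q where "q \<in> P" "p dvd q"
        using prime_dvd_prod_iff[OF insert(1) p, of "\<lambda>x. x"] by (auto simp: M_def)
      then show False
        using primes_dvd_imp_eq[OF p] insert by auto
    qed
    then have not_dvd: "\<not> p dvd d" if "d dvd M" for d
      using that dvd_trans by blast
    have step: "d dvd p * M \<longleftrightarrow> d dvd M \<or> (\<exists>e. d = p * e \<and> e dvd M)" for d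
    proof
      assume d: "d dvd p * M"
      show "d dvd M \<or> (\<exists>e. d = p * e \<and> e dvd M)"
      proof (cases "p dvd d")
        case True
        then show ?thesis
          using d p by (auto elim!: dvdE[of p d] simp: prime_gt_0_nat)
      next
        case False
        then have "coprime d p"
          using p prime_imp_coprime coprime_commute by blast
        then show ?thesis
          using d by (simp add: coprime_dvd_mult_right_iff)
      qed
    qed (use p in auto)
    have fin: "finite {d. d dvd M}"
      using M by (rule finite_divisors_nat)
    have fin2: "finite {(m, n). m * n dvd M}"
      by (rule finite_subset[OF _ finite_cartesian_product[OF fin fin]])
        (auto dest: dvd_mult_left dvd_mult_right)
    have "{d. d dvd p * M} = {d. d dvd M} \<union> (*) p ` {d. d dvd M}"
      using step by auto
    moreover have "card ({d. d dvd M} \<union> (*) p ` {d. d dvd M}) = card {d. d dvd M} + card {d. d dvd M}"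
    proof (subst card_Un_disjoint)
      show "card {d. d dvd M} + card ((*) p ` {d. d dvd M}) = card {d. d dvd M} + card {d. d dvd M}"
        using p by (subst card_image) (auto simp: inj_on_def)
    qed (use fin not_dvd in auto)
    ultimately have two: "card {d. d dvd p * M} = 2 * card {d. d dvd M}"
      by simp
    let ?T = "{(m, n). m * n dvd M}"
    let ?L = "(\<lambda>(m, n). (p * m, n)) ` ?T" and ?R = "(\<lambda>(m, n). (m, p * n)) ` ?T"
    have "{(m, n). m * n dvd p * M} = ?T \<union> (?L \<union> ?R)"
    proof (intro equalityI subsetI)
      fix x assume "x \<in> {(m, n). m * n dvd p * M}"
      then obtain m n where x: "x = (m, n)" and mn: "m * n dvd p * M"
        by auto
      show "x \<in> ?T \<union> (?L \<union> ?R)"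
      proof (cases "m * n dvd M")
        case False
        then obtain e where e: "m * n = p * e" "e dvd M"
          using mn step by blast
        then have "p dvd m \<or> p dvd n"
          using p by (metis dvd_triv_left prime_dvd_mult_iff)
        then show ?thesis
          using e p x by (force elim!: dvdE simp: prime_gt_0_nat ac_simps)
      qed (use x in auto)
    qed (auto simp: ac_simps)
    moreover have "card (?T \<union> (?L \<union> ?R)) = card ?T + (card ?T + card ?T)"
    proof -
      have "?T \<inter> (?L \<union> ?R) = {}" "?L \<inter> ?R = {}"
        using not_dvd by (fastforce dest: dvd_mult_left dvd_mult_right)+
      moreover have "card ?L = card ?T" "card ?R = card ?T"
        using p by (auto intro!: card_image simp: inj_on_def)
      ultimately show ?thesis
        using fin2 by (simp add: card_Un_disjoint)
    qed
    ultimately have "card {(m, n). m * n dvd p * M} = 3 * card ?T"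
      by simp
    then show ?case
      using two insert by (simp add: prod M_def)
  qed
  then show "card {d. d dvd \<Prod>P} = 2 ^ card P" "card {(m, n). m * n dvd \<Prod>P} = 3 ^ card P"
    by auto
qed

lemma obtain_coprime_squarefree_family:
  obtains N :: "nat \<Rightarrow> nat" where
    "\<And>i. N i > 0"
    "\<And>i j. i \<noteq> j \<Longrightarrow> coprime (N i) (N j)"
    "\<And>i. card {d. d dvd N i} = 2 ^ r"
    "\<And>i. card {(m, n). m * n dvd N i} = 3 ^ r"
proof
  define e where "e = enumerate {p::nat. prime p}"
  have inj: "inj e"
    unfolding e_def using primes_infinite by (intro strict_mono_imp_inj_on strict_mono_enumerate)
  have prime: "prime (e i)" for i
    using enumerate_in_set[OF primes_infinite, of i] by (simp add: e_def)
  \<comment> \<open>Consecutive blocks of \<open>r\<close> primes.\<close>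
  define P where "P i = (\<lambda>j. e (i * r + j)) ` {..<r}" for i
  have "inj_on (\<lambda>j. e (i * r + j)) {..<r}" for i
    by (auto intro!: inj_onI dest: injD[OF inj])
  then have P: "finite (P i)" "card (P i) = r" "\<And>p. p \<in> P i \<Longrightarrow> prime p" for i
    using prime by (auto simp: P_def card_image)
  show "\<Prod>(P i) > 0" for i
    using P by (intro prod_pos prime_gt_0_nat)
  show "card {d. d dvd \<Prod>(P i)} = 2 ^ r" "card {(m, n). m * n dvd \<Prod>(P i)} = 3 ^ r" for i
    using card_divisors_prod_primes[of "P i"] P by auto
  show "coprime (\<Prod>(P i)) (\<Prod>(P j))" if "i \<noteq> j" for i j
  proof (intro prod_coprime_left prod_coprime_right)
    fix p q assume pq: "p \<in> P i" "q \<in> P j"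
    then obtain a b where ab: "a < r" "b < r" "p = e (i * r + a)" "q = e (j * r + b)"
      by (auto simp: P_def)
    have "(i * r + a) div r = i" "(j * r + b) div r = j"
      using ab by auto
    then have "p \<noteq> q"
      using ab inj that by (metis injD)
    then show "coprime p q"
      using P(3) pq primes_coprime by blast
  qed
qed

section \<open>The coefficients of a bounded projection are inconsistent\<close>

context helson_projection
begin

text \<open>
  The matrix with ones on a partial matching \<open>F\<close> has norm at most \<open>1\<close>, but its averaged projection
  has the coefficients of \<open>F\<close> side by side in the first row, whose \<open>\<ell>\<^sup>2\<close> norm is therefore at most
  \<open>K\<close>.
\<close>

lemma sum_coeff_square_le:
  assumes F: "finite F" "F \<subseteq> {1..} \<times> {1..}"
    and inj: "inj_on fst F" "inj_on snd F" "inj_on (\<lambda>(m, n). m * n) F"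
  shows "(\<Sum>(m, n)\<in>F. (cmod (coeff m n))\<^sup>2) \<le> K\<^sup>2"
proof -
  define g where "g k = (\<Sum>(m, n)\<in>F. if m * n = k then coeff m n else 0)" for k
  define H where "H = (\<lambda>(m, n). m * n) ` F"
  have H: "finite H" "0 \<notin> H"
    using F by (auto simp: H_def)
  let ?S = "\<Sum>k\<in>H. (cmod (g k))\<^sup>2"
  have S: "?S \<ge> 0"
    by (simp add: sum_nonneg)
  have g: "g (fst p * snd p) = coeff (fst p) (snd p)" if "p \<in> F" for p
  proof -
    have "g (fst p * snd p) = (\<Sum>q\<in>F. if q = p then coeff (fst q) (snd q) else 0)"
      unfolding g_def using inj_onD[OF inj(3) _ _ that]
      by (intro sum.cong) (auto simp: case_prod_unfold)
    then show ?thesis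
      using F(1) that by simp
  qed
  have "norm (weighted_matrix F w) \<le> 1" if "\<And>m n. cmod (w m n) \<le> 1" for w
    using norm_weighted_matrix_le_matching[OF F(1) that inj(1,2)] .
  \<comment> \<open>Testing the first row against its own complex conjugate yields its squared norm.\<close>
  from averaged_projection_bound[OF F, of "{1}" H 1 "\<lambda>k. cnj (g k)" "\<lambda>_. 1", folded g_def, OF _ _ H this]
  have "cmod (\<Sum>k\<in>H. g k * cnj (g k)) \<le> K * sqrt ?S"
    by simp
  also have "(\<Sum>k\<in>H. g k * cnj (g k)) = of_real ?S"
    by (simp only: of_real_sum complex_norm_square)
  finally have "?S \<le> K * sqrt ?S"
    using S by (simp only: norm_of_real abs_of_nonneg)
  then have "sqrt ?S * sqrt ?S \<le> K * sqrt ?S"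
    using S by simp
  then have "sqrt ?S \<le> K"
    using S K_nonneg by (cases "?S = 0") (auto simp del: real_sqrt_mult_self dest: mult_right_le_imp_le)
  then have "?S \<le> K\<^sup>2"
    by (rule sqrt_le_D)
  also have "?S = (\<Sum>(m, n)\<in>F. (cmod (coeff m n))\<^sup>2)"
    unfolding H_def by (subst sum.reindex[OF inj(3)]) (auto simp: case_prod_unfold g)
  finally show ?thesis .
qed

text \<open>
  If every \<open>N i\<close> had a nontrivial factorization with a large coefficient, coprimality would make
  finitely many of these factorizations a matching with distinct products, and the sum of their
  squared coefficients would exceed \<open>K\<^sup>2\<close>.
\<close>

lemma coeff_small_on_some:
  fixes N :: "nat \<Rightarrow> nat"
  assumes N: "\<And>i. N i > 0" "\<And>i j. i \<noteq> j \<Longrightarrow> coprime (N i) (N j)" and "\<epsilon> > 0"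
  obtains i where "\<And>m n. m > 1 \<Longrightarrow> n > 1 \<Longrightarrow> m * n dvd N i \<Longrightarrow> cmod (coeff m n) \<le> \<epsilon>"
proof (rule ccontr)
  assume "\<not> thesis"
  then have "\<forall>i. \<exists>p. fst p > 1 \<and> snd p > 1 \<and> fst p * snd p dvd N i \<and> cmod (coeff (fst p) (snd p)) > \<epsilon>"
    using that by (metis fst_conv snd_conv not_le)
  then obtain p where p: "\<And>i. fst (p i) > 1" "\<And>i. snd (p i) > 1"
      "\<And>i. fst (p i) * snd (p i) dvd N i" "\<And>i. cmod (coeff (fst (p i)) (snd (p i))) > \<epsilon>"
    by metis
  have distinct: "i = j" if "d dvd N i" "d dvd N j" "d > 1" for d i j
    using N(2)[of i j] that coprime_common_divisor_nat[of "N i" "N j" d] by auto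
  have dvd: "fst (p i) dvd N i" "snd (p i) dvd N i" for i
    using p(3)[of i] by (auto dest: dvd_mult_left dvd_mult_right)
  obtain L :: nat where L: "real L > (K / \<epsilon>)\<^sup>2"
    using reals_Archimedean2 by blast
  define F where "F = p ` {..<L}"
  have inj_p: "inj_on p {..<L}"
    by (rule inj_onI) (metis distinct dvd(1) p(1))
  have inj_F: "inj_on f F" if f: "\<And>i. f (p i) dvd N i" "\<And>i. f (p i) > 1"
    for f :: "nat \<times> nat \<Rightarrow> nat"
  proof (rule inj_onI)
    fix x y assume "x \<in> F" "y \<in> F" and eq: "f x = f y"
    then obtain i j where xy: "x = p i" "y = p j"
      by (auto simp: F_def)
    then have "i = j"
      using distinct[of "f x" i j] f[of i] f[of j] eq by simp
    then show "x = y"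
      using xy by simp
  qed
  have "(\<Sum>(m, n)\<in>F. (cmod (coeff m n))\<^sup>2) \<le> K\<^sup>2"
  proof (rule sum_coeff_square_le)
    show "finite F"
      by (simp add: F_def)
    show "F \<subseteq> {1..} \<times> {1..}"
      using p(1,2) by (simp add: F_def image_subset_iff mem_Times_iff less_imp_le)
    show "inj_on fst F" "inj_on snd F"
      using inj_F dvd p(1,2) by blast+
    show "inj_on (\<lambda>(m, n). m * n) F"
      using less_1_mult[OF p(1,2)] by (intro inj_F) (simp_all add: case_prod_unfold p(3))
  qed
  moreover have "(\<Sum>(m, n)\<in>F. (cmod (coeff m n))\<^sup>2) = (\<Sum>i<L. (cmod (coeff (fst (p i)) (snd (p i))))\<^sup>2)"
    unfolding F_def by (subst sum.reindex[OF inj_p]) (simp add: case_prod_unfold)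
  moreover have "real L * \<epsilon>\<^sup>2 \<le> (\<Sum>i<L. (cmod (coeff (fst (p i)) (snd (p i))))\<^sup>2)"
    using sum_mono[of "{..<L}" "\<lambda>_. \<epsilon>\<^sup>2" "\<lambda>i. (cmod (coeff (fst (p i)) (snd (p i))))\<^sup>2"]
      p(4) \<open>\<epsilon> > 0\<close> by (simp add: less_imp_le power_mono)
  ultimately have "real L * \<epsilon>\<^sup>2 \<le> K\<^sup>2"
    by simp
  then show False
    using L \<open>\<epsilon> > 0\<close> by (simp add: power_divide divide_less_eq)
qed

text \<open>
  The coefficients of all factorizations of \<open>k\<close> add up to \<open>1\<close>, and the nontrivial ones, at most one
  for each divisor of \<open>N\<close>, contribute at most \<open>1 / 2\<close>.
\<close>

lemma coeff_first_row_column: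
  assumes N: "N > 0" and k: "k dvd N" "k > 1"
    and small: "\<And>m n. m > 1 \<Longrightarrow> n > 1 \<Longrightarrow> m * n dvd N \<Longrightarrow> cmod (coeff m n) \<le> \<epsilon>"
    and \<epsilon>: "\<epsilon> \<ge> 0" "real (card {d. d dvd N}) * \<epsilon> \<le> 1 / 2"
  shows "Re (coeff 1 k + coeff k 1) \<ge> 1 / 2"
proof -
  let ?F = "{(m, n). m * n = k}"
  define F' where "F' = ?F - {(1, k), (k, 1)}"
  have fin: "finite {d. d dvd N}"
    using N by (rule finite_divisors_nat)
  have sub: "?F \<subseteq> {d. d dvd N} \<times> {d. d dvd N}"
    using k by (auto dest: dvd_mult_left dvd_mult_right)
  then have F: "finite ?F"
    by (rule finite_subset) (use fin in simp)
  have "1 = (\<Sum>(m, n)\<in>?F. coeff m n)"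
    using sum_coeff_factorizations[of k] k by simp
  also have "?F = insert (1, k) (insert (k, 1) F')"
    by (auto simp: F'_def)
  finally have "1 = coeff 1 k + (coeff k 1 + (\<Sum>(m, n)\<in>F'. coeff m n))"
    using F k by (subst (asm) sum.insert; simp add: F'_def)+
  then have "coeff 1 k + coeff k 1 = 1 - (\<Sum>(m, n)\<in>F'. coeff m n)"
    by (simp add: algebra_simps)
  moreover have "cmod (\<Sum>(m, n)\<in>F'. coeff m n) \<le> 1 / 2"
  proof -
    have le: "cmod (coeff m n) \<le> \<epsilon>" if "(m, n) \<in> F'" for m n
    proof (rule small)
      have mn: "m * n = k" "m \<noteq> 1" "n \<noteq> 1"
        using that by (auto simp: F'_def)
      then have "m * n > 0"
        using k by simp
      then have "m \<noteq> 0" "n \<noteq> 0"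
        by simp_all
      then show "m > 1" "n > 1"
        using mn(2,3) by linarith+
      show "m * n dvd N"
        using mn(1) k by simp
    qed
    have "inj_on fst F'"
      using k by (auto simp: F'_def inj_on_def)
    then have "card F' = card (fst ` F')"
      by (simp add: card_image)
    also have "\<dots> \<le> card {d. d dvd N}"
      using sub by (intro card_mono fin) (auto simp: F'_def)
    finally have "card F' \<le> card {d. d dvd N}" .
    have "cmod (\<Sum>(m, n)\<in>F'. coeff m n) \<le> (\<Sum>p\<in>F'. \<epsilon>)"
      using le by (intro sum_norm_le) auto
    also have "\<dots> \<le> real (card {d. d dvd N}) * \<epsilon>"
      using \<open>card F' \<le> card {d. d dvd N}\<close> \<epsilon>(1) by (simp add: mult_right_mono)
    finally show ?thesis
      using \<epsilon>(2) by simp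
  qed
  ultimately show ?thesis
    using abs_Re_le_cmod[of "\<Sum>(m, n)\<in>F'. coeff m n"] by simp
qed

text \<open>
  The test matrix has ones in the first row and the first column, at the divisors of \<open>N\<close>. Its norm
  is of the order of the square root of the number of divisors, while its averaged projection has
  entries of real part at least \<open>1 / 2\<close> at all positions with product dividing \<open>N\<close>.
\<close>

lemma factorization_count_bound:
  assumes N: "N > 0"
    and small: "\<And>m n. m > 1 \<Longrightarrow> n > 1 \<Longrightarrow> m * n dvd N \<Longrightarrow> cmod (coeff m n) \<le> \<epsilon>"
    and \<epsilon>: "\<epsilon> \<ge> 0" "real (card {d. d dvd N}) * \<epsilon> \<le> 1 / 2"
  shows "real (card {(m, n). m * n dvd N}) / 2
    \<le> K * sqrt (2 * card {d. d dvd N}) * card {d. d dvd N}"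
proof -
  let ?D = "{d. d dvd N}"
  have D: "finite ?D" "0 \<notin> ?D"
    using N by (auto intro: finite_divisors_nat)
  define F where "F = Pair 1 ` ?D \<union> (\<lambda>k. (k, 1::nat)) ` ?D"
  have F: "finite F" "F \<subseteq> {1..} \<times> {1..}"
    using D N by (auto simp: F_def Suc_le_eq intro: gr0I)
  have "card F \<le> card (Pair (1::nat) ` ?D) + card ((\<lambda>k. (k, 1::nat)) ` ?D)"
    unfolding F_def by (rule card_Un_le)
  also have "\<dots> \<le> card ?D + card ?D"
    by (intro add_mono card_image_le D)
  finally have card_F: "sqrt (card F) \<le> sqrt (2 * card ?D)"
    by simp
  have B: "norm (weighted_matrix F w) \<le> sqrt (2 * card ?D)" if "\<And>m n. cmod (w m n) \<le> 1" for w
  proof -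
    have "norm (weighted_matrix F w) \<le> sqrt (card F)"
      using norm_weighted_matrix_le_Frobenius[OF F(1) that] .
    then show ?thesis
      using card_F by (rule order_trans)
  qed
  define g where "g k = (\<Sum>(m, n)\<in>F. if m * n = k then coeff m n else 0)" for k
  have g: "Re (g k) \<ge> (if k dvd N then 1 / 2 else 0)" for k
  proof -
    have "g k = (\<Sum>(m, n)\<in>{p\<in>F. fst p * snd p = k}. coeff m n)"
      unfolding g_def using F(1) by (simp add: sum.inter_filter case_prod_unfold)
    also have "{p\<in>F. fst p * snd p = k} = (if k dvd N then {(1, k), (k, 1)} else {})"
      by (auto simp: F_def)
    finally have eq: "g k = (if k dvd N then \<Sum>(m, n)\<in>{(1, k), (k, 1)}. coeff m n else 0)"
      by simp
    show ?thesis
    proof (cases "k dvd N \<and> k > 1")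
      case True
      then show ?thesis
        using coeff_first_row_column[OF N _ _ small \<epsilon>, of k] by (simp add: eq)
    next
      case False
      \<comment> \<open>The positions \<open>(1, k)\<close> and \<open>(k, 1)\<close> coincide for \<open>k = 1\<close>; the weight of this single position is exactly \<open>1\<close>.\<close>
      have "coeff 1 1 = 1"
      proof -
        have "{(m, n). m * n = (1::nat)} = {(1, 1)}"
          by auto
        then show ?thesis
          using sum_coeff_factorizations[of 1] by simp
      qed
      moreover have "k = 1" if "k dvd N"
        using False that N by (cases k) auto
      ultimately show ?thesis
        by (auto simp: eq)
    qed
  qed
  have "real (card {(m, n). m * n dvd N}) / 2 = (\<Sum>p\<in>{(m, n). m * n dvd N}. 1 / 2)"
    by simp
  also have "\<dots> = (\<Sum>p\<in>{p \<in> ?D \<times> ?D. fst p * snd p dvd N}. 1 / 2)"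
    by (rule sum.cong) (auto dest: dvd_mult_left dvd_mult_right)
  also have "\<dots> = (\<Sum>p\<in>?D \<times> ?D. if fst p * snd p dvd N then 1 / 2 else (0::real))"
    using D(1) by (intro sum.inter_filter) simp
  also have "\<dots> \<le> (\<Sum>p\<in>?D \<times> ?D. Re (g (fst p * snd p)))"
    by (intro sum_mono g)
  also have "\<dots> = Re (\<Sum>m\<in>?D. \<Sum>n\<in>?D. g (m * n) * 1 * 1)"
    by (simp add: sum.cartesian_product case_prod_unfold)
  also have "\<dots> \<le> cmod (\<Sum>m\<in>?D. \<Sum>n\<in>?D. g (m * n) * 1 * 1)"
    by (rule complex_Re_le_cmod)
  also have "\<dots> \<le> K * sqrt (2 * card ?D) * sqrt (\<Sum>n\<in>?D. (cmod 1)\<^sup>2) * sqrt (\<Sum>n\<in>?D. (cmod 1)\<^sup>2)"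
    using averaged_projection_bound[OF F D D B, of "\<lambda>_. 1" "\<lambda>_. 1", folded g_def] .
  also have "\<dots> = K * sqrt (2 * card ?D) * card ?D"
    by simp
  finally show ?thesis .
qed

lemma inconsistent: False
proof -
  \<comment> \<open>\<open>9 / 8\<close> is the square of \<open>3 / (2 * sqrt 2)\<close>, the gain per prime factor.\<close>
  obtain r where r: "8 * K\<^sup>2 < (9 / 8) ^ r"
    using real_arch_pow[of "9 / 8"] by auto
  obtain N :: "nat \<Rightarrow> nat" where N: "\<And>i. N i > 0" "\<And>i j. i \<noteq> j \<Longrightarrow> coprime (N i) (N j)"
    and card: "\<And>i. card {d. d dvd N i} = 2 ^ r" "\<And>i. card {(m, n). m * n dvd N i} = 3 ^ r"
    using obtain_coprime_squarefree_family by blast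
  let ?\<epsilon> = "1 / (2 * 2 ^ r) :: real"
  obtain i where "\<And>m n. m > 1 \<Longrightarrow> n > 1 \<Longrightarrow> m * n dvd N i \<Longrightarrow> cmod (coeff m n) \<le> ?\<epsilon>"
    by (rule coeff_small_on_some[OF N, where \<epsilon> = ?\<epsilon>]) auto
  then have "real (card {(m, n). m * n dvd N i}) / 2
    \<le> K * sqrt (2 * card {d. d dvd N i}) * card {d. d dvd N i}"
    using N(1) by (intro factorization_count_bound[where \<epsilon> = ?\<epsilon>]) (auto simp: card)
  then have "3 ^ r \<le> 2 * K * sqrt (2 * 2 ^ r) * 2 ^ r"
    by (simp add: card)
  then have "(3 ^ r)\<^sup>2 \<le> (2 * K * sqrt (2 * 2 ^ r) * 2 ^ r)\<^sup>2"
    by (rule power_mono) simp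
  moreover have "(3 ^ r)\<^sup>2 = (9::real) ^ r"
    using power_mult[of "3::real" r 2] power_mult[of "3::real" 2 r] by (simp add: mult.commute)
  moreover have "(8::real) ^ r = 2 ^ r * (2 ^ r)\<^sup>2"
    by (simp add: power2_eq_square flip: power_mult_distrib)
  ultimately have "9 ^ r \<le> 8 * K\<^sup>2 * 8 ^ r"
    by (simp add: power_mult_distrib)
  then show False
    using r by (simp add: power_divide field_simps)
qed

end

section \<open>Compact and bounded operators\<close>

lemma cscale_add: "cscale c (x + y) = cscale c x + cscale c y"
  using linear_add[OF bounded_linear.linear[OF bounded_linear_cscale]] .

lemma cscale_cscale: "cscale c (cscale d x) = cscale (c * d) x"
  by transfer (simp add: mult.assoc)

lemma bounded_ops_add: "A \<in> bounded_ops \<Longrightarrow> B \<in> bounded_ops \<Longrightarrow> A + B \<in> bounded_ops"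
  by (simp add: bounded_ops_def blinfun.add_left cscale_add)

lemma bounded_ops_cscale_op: "A \<in> bounded_ops \<Longrightarrow> cscale_op c A \<in> bounded_ops"
  by (simp add: bounded_ops_def blinfun_apply_cscale_op cscale_cscale mult.commute)

lemma bounded_ops_matrix_unit: "matrix_unit m n \<in> bounded_ops"
  by (simp add: bounded_ops_def matrix_unit_apply cscale.rep_eq cscale_cscale)

lemma compact_opsI:
  assumes "A \<in> bounded_ops" "compact S" "blinfun_apply A ` cball 0 1 \<subseteq> S"
  shows "A \<in> compact_ops"
proof -
  let ?C = "closure (blinfun_apply A ` cball 0 1)"
  have "?C \<subseteq> S"
    using assms by (intro closure_minimal compact_imp_closed)
  then have "S \<inter> ?C = ?C"
    by blast
  then have "compact ?C"
    using compact_Int_closed[OF \<open>compact S\<close> closed_closure, of "blinfun_apply A ` cball 0 1"] by simp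
  then show ?thesis
    using assms(1) by (simp add: compact_ops_def)
qed

lemma compact_ops_add:
  assumes "A \<in> compact_ops" "B \<in> compact_ops"
  shows "A + B \<in> compact_ops"
proof (rule compact_opsI)
  let ?S = "\<lambda>A. closure (blinfun_apply A ` cball 0 1)"
  show "A + B \<in> bounded_ops"
    using assms by (simp add: compact_ops_def bounded_ops_add)
  show "compact {x + y | x y. x \<in> ?S A \<and> y \<in> ?S B}"
    using assms by (intro compact_sums) (auto simp: compact_ops_def)
  show "blinfun_apply (A + B) ` cball 0 1 \<subseteq> {x + y | x y. x \<in> ?S A \<and> y \<in> ?S B}"
  proof (intro image_subsetI CollectI exI conjI)
    fix x :: ell2 assume x: "x \<in> cball 0 1"
    show "blinfun_apply (A + B) x = blinfun_apply A x + blinfun_apply B x"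
      by (rule blinfun.add_left)
    show "blinfun_apply A x \<in> ?S A" "blinfun_apply B x \<in> ?S B"
      using x by (meson closure_subset imageI subsetD)+
  qed
qed

lemma compact_ops_cscale_op:
  assumes "A \<in> compact_ops"
  shows "cscale_op c A \<in> compact_ops"
proof (rule compact_opsI)
  let ?S = "closure (blinfun_apply A ` cball 0 1)"
  show "cscale_op c A \<in> bounded_ops"
    using assms by (simp add: compact_ops_def bounded_ops_cscale_op)
  show "compact (cscale c ` ?S)"
    using assms by (intro compact_continuous_image linear_continuous_on bounded_linear_cscale)
      (auto simp: compact_ops_def)
  show "blinfun_apply (cscale_op c A) ` cball 0 1 \<subseteq> cscale c ` ?S"
    using closure_subset by (fastforce simp: blinfun_apply_cscale_op)
qed

lemma compact_ops_matrix_unit: "matrix_unit m n \<in> compact_ops"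
proof (rule compact_opsI)
  show "matrix_unit m n \<in> bounded_ops"
    by (rule bounded_ops_matrix_unit)
  show "compact ((\<lambda>c. cscale c (unit_vec m)) ` cball 0 1)"
    by (intro compact_continuous_image linear_continuous_on bounded_linear_cscale_left) simp
  show "blinfun_apply (matrix_unit m n) ` cball 0 1 \<subseteq> (\<lambda>c. cscale c (unit_vec m)) ` cball 0 1"
    using cmod_ell2_nth_le order_trans by (fastforce simp: matrix_unit_apply)
qed

lemma no_bounded_projection_onto_helson:
  assumes "X \<subseteq> bounded_ops"
    and "\<And>A B. A \<in> X \<Longrightarrow> B \<in> X \<Longrightarrow> A + B \<in> X"
    and "\<And>c A. A \<in> X \<Longrightarrow> cscale_op c A \<in> X"
    and "\<And>m n. matrix_unit m n \<in> X"
  shows "\<not> bounded_projection X {A \<in> X. helson A} Q"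
proof
  assume "bounded_projection X {A \<in> X. helson A} Q"
  note Q = this[unfolded bounded_projection_def]
  then obtain K where K: "\<forall>A\<in>X. norm (Q A) \<le> K * norm A"
    by (elim conjE exE)
  interpret helson_projection X Q "max K 0"
  proof
    show "norm (Q A) \<le> max K 0 * norm A" if "A \<in> X" for A
      using K that by (meson max.cobounded1 mult_right_mono norm_ge_zero order_trans)
    show "Q A = A" if "A \<in> X" "helson A" for A
    proof -
      have "A \<in> Q ` X"
        using Q that by simp
      then show ?thesis
        using Q by force
    qed
    show "helson (Q A)" if "A \<in> X" for A
      using Q that by blast
  qed (use assms Q in \<open>simp_all\<close>)
  show False
    by (rule inconsistent)
qed

theorem theorem5:
  "\<not> (\<exists>Q. bounded_projection compact_ops compact_helson Q) \<and>
   \<not> (\<exists>Q. bounded_projection bounded_ops bounded_helson Q)"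
proof -
  have "\<not> bounded_projection compact_ops compact_helson Q" for Q
    unfolding compact_helson_def
    by (intro no_bounded_projection_onto_helson compact_ops_add compact_ops_cscale_op
      compact_ops_matrix_unit) (auto simp: compact_ops_def)
  moreover have "\<not> bounded_projection bounded_ops bounded_helson Q" for Q
    unfolding bounded_helson_def
    by (intro no_bounded_projection_onto_helson bounded_ops_add bounded_ops_cscale_op
      bounded_ops_matrix_unit order_refl)
  ultimately show ?thesis by blast
qed

end
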